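(* Let $\vec a=(a_1,\ldots,a_n)$ be a vector of relatively prime positive integers. For $1\le i\le n$, let $d_i=\gcd(\vec a_{-i})$, and let $p=d_1\cdots d_n$. Then: \begin{enumerate} \item If $s\in\mathbb{Z}_{\ge 0}$ and $b_i\in\mathbb{Z}$ with $0\le b_i<d_i$ for all $i$, then $f\left(\vec a; sp+\sum_i a_ib_i\right)=f(\vec a; sp)$. \item If $t\in\mathbb{Z}_{\ge 0}$ is sufficiently large, then there exist $s\in\mathbb{Z}_{\ge 0}$ and $b_i\in\mathbb{Z}$ with $0\le b_i<d_i$ such that $t=sp+\sum_i a_ib_i$. \item For $1\le i\le n$, let $a'_i=\dfrac{a_i}{\prod_{j\ne i}d_j}$ and $\vec a'=(a'_1,\ldots,a'_n)$. Then $f(\vec a; sp)=f(\vec a'; s)$ for all $s\in\mathbb{Z}_{\ge 0}$. \item For all sufficiently large $s\in\mathbb{Z}_{\ge 0}$, $f\big(\vec a;(s+1)p\big)>f(\vec a; sp)$. \end{enumerate}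
   Context: For a vector $\vec a=(a_1,\ldots,a_n)$ of positive integers and $t\in\mathbb{Z}_{\ge 0}$, the restricted partition function is $f(\vec a;t)=\#\{(x_1,\ldots,x_n)\in\mathbb{Z}_{\ge 0}^n:\ a_1x_1+\cdots+a_nx_n=t\}$. For $1\le i\le n$, $\vec a_{-i}=(a_1,\ldots,a_{i-1},a_{i+1},\ldots,a_n)$. *)

theory Defs
  imports Complex_Main
begin

text \<open>
  A vector of positive integers is a list of positive natural numbers, with entries indexed
  from 0. Nonnegative integers are rendered as natural numbers throughout.
\<close>

definition restricted_partition :: "nat list \<Rightarrow> nat \<Rightarrow> nat" where
  "restricted_partition a t =
     card {x :: nat list. length x = length a \<and> (\<Sum>i<length a. a ! i * x ! i) = t}"

definition omit :: "nat \<Rightarrow> 'a list \<Rightarrow> 'a list" where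
  "omit i a = take i a @ drop (Suc i) a"

definition omit_gcd :: "nat list \<Rightarrow> nat \<Rightarrow> nat" where
  "omit_gcd a i = Gcd (set (omit i a))"

definition omit_gcd_prod :: "nat list \<Rightarrow> nat" where
  "omit_gcd_prod a = (\<Prod>i<length a. omit_gcd a i)"

text \<open>
  For a list with overall gcd 1 the division below is exact; see \<open>prod_omit_gcd_dvd\<close>.
\<close>

definition reduced_vector :: "nat list \<Rightarrow> nat list" where
  "reduced_vector a =
     map (\<lambda>i. a ! i div (\<Prod>j\<in>{..<length a} - {i}. omit_gcd a j)) [0..<length a]"

text \<open>The set counted by \<^const>\<open>restricted_partition\<close> is finite, so its cardinality is meaningful.\<close>

lemma finite_restricted_partition:
  assumes "\<forall>k\<in>set a. 0 < k"
  shows "finite {x :: nat list. length x = length a \<and> (\<Sum>i<length a. a ! i * x ! i) = t}"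
proof (rule finite_subset)
  show "{x :: nat list. length x = length a \<and> (\<Sum>i<length a. a ! i * x ! i) = t}
        \<subseteq> {x. set x \<subseteq> {..t} \<and> length x = length a}"
  proof safe
    fix x :: "nat list" and k
    assume len: "length x = length a" and k: "k \<in> set x" and t: "t = (\<Sum>i<length a. a ! i * x ! i)"
    obtain i where i: "i < length a" "k = x ! i"
      using k len by (metis in_set_conv_nth)
    have "x ! i \<le> a ! i * x ! i"
      using assms i(1) by (simp add: Suc_leI)
    also have "\<dots> \<le> (\<Sum>i<length a. a ! i * x ! i)"
      by (rule member_le_sum) (use i(1) in auto)
    finally show "k \<le> (\<Sum>i<length a. a ! i * x ! i)" using i(2) by simp
  qed
  show "finite {x :: nat list. set x \<subseteq> {..t} \<and> length x = length a}"
    by (rule finite_lists_length_eq) simp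
qed

lemma omit_gcd_dvd:
  assumes "i < length a" "j \<noteq> i"
  shows "omit_gcd a j dvd a ! i"
proof -
  have "a ! i \<in> set (omit j a)"
  proof (cases "i < j")
    case True
    then have "a ! i \<in> set (take j a)"
      using assms by (auto simp: in_set_conv_nth)
    then show ?thesis by (simp add: omit_def)
  next
    case False
    then have "Suc j \<le> i" using assms by simp
    then have "drop (Suc j) a ! (i - Suc j) = a ! i" "i - Suc j < length (drop (Suc j) a)"
      using assms by auto
    then have "a ! i \<in> set (drop (Suc j) a)" by (metis nth_mem)
    then show ?thesis by (simp add: omit_def)
  qed
  then show ?thesis by (simp add: omit_gcd_def)
qed

lemma coprime_omit_gcd:
  assumes "Gcd (set a) = 1" "i \<noteq> j"
  shows "coprime (omit_gcd a i) (omit_gcd a j)"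
proof (rule coprimeI)
  fix c assume c: "c dvd omit_gcd a i" "c dvd omit_gcd a j"
  have "c dvd k" if k: "k \<in> set a" for k
  proof -
    obtain l where l: "l < length a" "k = a ! l" using k by (metis in_set_conv_nth)
    show ?thesis
    proof (cases "l = i")
      case True
      then have "omit_gcd a j dvd a ! l" using l assms(2) by (intro omit_gcd_dvd) auto
      with c(2) l(2) show ?thesis by (auto intro: dvd_trans)
    next
      case False
      then have "omit_gcd a i dvd a ! l" using l by (intro omit_gcd_dvd) auto
      with c(1) l(2) show ?thesis by (auto intro: dvd_trans)
    qed
  qed
  then have "c dvd Gcd (set a)" by (rule Gcd_greatest)
  then show "is_unit c" using assms(1) by simp
qed

lemma prod_omit_gcd_dvd:
  assumes "Gcd (set a) = 1" "i < length a"
  shows "(\<Prod>j\<in>{..<length a} - {i}. omit_gcd a j) dvd a ! i"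
proof -
  have "(\<Prod>j\<in>J. omit_gcd a j) dvd a ! i" if "finite J" "i \<notin> J" for J
    using that
  proof (induction J rule: finite_induct)
    case (insert j J)
    have "coprime (omit_gcd a j) (\<Prod>j\<in>J. omit_gcd a j)"
      using insert.hyps assms(1) by (intro prod_coprime_right coprime_omit_gcd) auto
    moreover have "omit_gcd a j dvd a ! i"
      using insert.prems assms(2) by (intro omit_gcd_dvd) auto
    ultimately show ?case using insert by (simp add: divides_mult)
  qed simp
  then show ?thesis by simp
qed

end

theory Submission
  imports Defs "HOL-Number_Theory.Cong" "HOL-Real_Asymp.Real_Asymp"
begin

text \<open>
  Modulo \<open>d_i\<close> every summand except \<open>a_i x_i\<close> vanishes and \<open>a_i\<close> is invertible, so the solutions of
  \<open>\<Sum> a_i x_i = s p + \<Sum> a_i b_i\<close> are exactly \<open>x_i = b_i + d_i y_i\<close> with \<open>\<Sum> a'_i y_i = s\<close>. This gives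
  (1) and (3); (2) is the Chinese remainder theorem.

  For (4), omitting any entry of \<open>a'\<close> leaves a vector with gcd 1. Write \<open>f\<close> for the number of
  solutions in \<open>n\<close> unknowns and \<open>W_i\<close> for the number of those with the \<open>i\<close>-th unknown omitted, so that
  \<open>f(t + a_i) - f(t) = W_i(t + a_i)\<close>. If for some slowly varying \<open>w\<close> the relation
  \<open>f(t + h) - f(t) = h w(t) + O(t^q)\<close> holds for \<open>h = a_i\<close>, for all \<open>i\<close>, then it holds for \<open>h = 1\<close>: the set
  of such \<open>h\<close> is closed under sums and differences and hence contains the gcd. With \<open>w = 0\<close> this
  shows that \<open>W_i(t + 1) - W_i(t) = O(t^(n-3))\<close>. Comparing \<open>a_k\<close> steps of size \<open>a_i\<close> with \<open>a_i\<close> steps of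
  size \<open>a_k\<close> then shows that \<open>W_i / a_i\<close> does not depend on \<open>i\<close> up to \<open>O(t^(n-3))\<close>, so
  \<open>f(t + 1) - f(t) = W_k(t) / a_k + O(t^(n-3))\<close>, where \<open>W_k(t)\<close> grows at least like \<open>t^(n-2)\<close>.
\<close>

section \<open>Solutions of a linear equation over a finite index set\<close>

text \<open>Solutions are functions forced to 0 off \<open>I\<close>, so each is represented once
  and omitting an unknown means passing to \<open>I - {i}\<close> without reindexing.\<close>

definition solutions :: "'i set \<Rightarrow> ('i \<Rightarrow> nat) \<Rightarrow> nat \<Rightarrow> ('i \<Rightarrow> nat) set" where
  "solutions I a t = {x. (\<forall>j. j \<notin> I \<longrightarrow> x j = 0) \<and> (\<Sum>j\<in>I. a j * x j) = t}"

definition num_solutions :: "'i set \<Rightarrow> ('i \<Rightarrow> nat) \<Rightarrow> nat \<Rightarrow> nat" where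
  "num_solutions I a t = card (solutions I a t)"

lemma restricted_partition_eq_num_solutions:
  "restricted_partition a t = num_solutions {..<length a} ((!) a) t"
proof -
  let ?f = "\<lambda>(x :: nat list) j. if j < length a then x ! j else 0"
  have "bij_betw ?f {x. length x = length a \<and> (\<Sum>i<length a. a ! i * x ! i) = t}
          (solutions {..<length a} ((!) a) t)"
  proof (rule bij_betw_byWitness[where f' = "\<lambda>x. map x [0..<length a]"], goal_cases)
    case 1
    show ?case by (auto intro!: nth_equalityI)
  next
    case 2
    show ?case by (auto simp: solutions_def fun_eq_iff)
  next
    case 3
    show ?case by (auto simp: solutions_def)
  next
    case 4
    show ?case by (auto simp: solutions_def)
  qed
  then show ?thesis
    unfolding restricted_partition_def num_solutions_def by (rule bij_betw_same_card)
qed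

lemma finite_solutions:
  assumes "finite I" "\<And>i. i \<in> I \<Longrightarrow> 0 < a i"
  shows "finite (solutions I a t)"
proof (rule finite_subset)
  show "solutions I a t \<subseteq> {x. \<forall>j. (j \<in> I \<longrightarrow> x j \<in> {..t}) \<and> (j \<notin> I \<longrightarrow> x j = 0)}"
  proof safe
    fix x j assume x: "x \<in> solutions I a t" and j: "j \<in> I"
    have "x j \<le> a j * x j" using assms(2)[OF j] by simp
    also have "\<dots> \<le> (\<Sum>j\<in>I. a j * x j)"
      using j assms(1) by (intro member_le_sum) auto
    finally show "x j \<le> t" using x by (simp add: solutions_def)
  qed (simp add: solutions_def)
  show "finite {x. \<forall>j. (j \<in> I \<longrightarrow> x j \<in> {..t}) \<and> (j \<notin> I \<longrightarrow> x j = 0)}"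
    using assms(1) by (intro finite_set_of_finite_funs) auto
qed

lemma solutions_remove:
  assumes "finite I" "i \<in> I"
  shows "solutions (I - {i}) a t = {x \<in> solutions I a t. x i = 0}"
proof -
  have "(\<Sum>j\<in>I. a j * x j) = a i * x i + (\<Sum>j\<in>I - {i}. a j * x j)" for x
    using assms by (intro sum.remove)
  then show ?thesis using assms(2) by (auto simp: solutions_def)
qed

lemma num_solutions_below:
  assumes "finite I" "i \<in> I" "t < a i"
  shows "num_solutions I a t = num_solutions (I - {i}) a t"
proof -
  have "x i = 0" if "x \<in> solutions I a t" for x
  proof (rule ccontr)
    assume "x i \<noteq> 0"
    then have "a i \<le> a i * x i" by simp
    also have "\<dots> \<le> (\<Sum>j\<in>I. a j * x j)"
      using assms by (intro member_le_sum) auto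
    finally show False using that assms(3) by (simp add: solutions_def)
  qed
  then have "solutions (I - {i}) a t = solutions I a t"
    using solutions_remove[OF assms(1,2)] by blast
  then show ?thesis by (simp add: num_solutions_def)
qed

text \<open>Raising coordinate \<open>i\<close> by one matches the solutions for \<open>t\<close>
  with those for \<open>t + a i\<close> in which \<open>x i\<close> is nonzero; the rest have
  \<open>x i = 0\<close> and so do not involve unknown \<open>i\<close>.\<close>

lemma num_solutions_add:
  assumes "finite I" "\<And>j. j \<in> I \<Longrightarrow> 0 < a j" "i \<in> I"
  shows "num_solutions I a (t + a i) = num_solutions I a t + num_solutions (I - {i}) a (t + a i)"
proof -
  let ?P = "{x \<in> solutions I a (t + a i). x i \<noteq> 0}"
  have sum_upd: "(\<Sum>j\<in>I. a j * (x(i := k)) j) = a i * k + (\<Sum>j\<in>I - {i}. a j * x j)" for x k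
    using assms(1,3) by (simp add: sum.remove[of I i])
  have sum_x: "(\<Sum>j\<in>I. a j * x j) = a i * x i + (\<Sum>j\<in>I - {i}. a j * x j)" for x
    using assms(1,3) by (simp add: sum.remove[of I i])
  have "bij_betw (\<lambda>x. x(i := Suc (x i))) (solutions I a t) ?P"
  proof (rule bij_betw_byWitness[where f' = "\<lambda>x. x(i := x i - 1)"], goal_cases)
    case 3
    show ?case
      using assms(3) by (auto simp: solutions_def sum_upd sum_x simp del: fun_upd_apply)
        (auto simp: sum_upd)
  next
    case 4
    show ?case
    proof safe
      fix x assume x: "x \<in> solutions I a (t + a i)" "0 < x i"
      then obtain k where k: "x i = Suc k" by (cases "x i") auto
      have "(\<Sum>j\<in>I. a j * (x(i := x i - 1)) j) = t"
        using x k unfolding sum_upd by (simp add: solutions_def sum_x)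
      then show "x(i := x i - 1) \<in> solutions I a t"
        using x assms(3) by (auto simp: solutions_def)
    qed
  qed auto
  then have "card ?P = num_solutions I a t"
    by (simp add: bij_betw_same_card num_solutions_def)
  moreover have "card (?P \<union> solutions (I - {i}) a (t + a i))
      = card ?P + card (solutions (I - {i}) a (t + a i))"
    using finite_solutions[of I a "t + a i"] assms
    by (intro card_Un_disjoint) (auto simp: solutions_remove)
  moreover have "?P \<union> solutions (I - {i}) a (t + a i) = solutions I a (t + a i)"
    using solutions_remove[OF assms(1,3)] by auto
  ultimately show ?thesis
    unfolding num_solutions_def by argo
qed

section \<open>Polynomial bounds for the number of solutions\<close>

lemma num_solutions_empty: "num_solutions {} a t = (if t = 0 then 1 else 0)"
proof -
  have "solutions {} a t = (if t = 0 then {\<lambda>_. 0} else {})"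
    by (auto simp: solutions_def)
  then show ?thesis by (simp add: num_solutions_def)
qed

lemma num_solutions_singleton:
  assumes "0 < a i"
  shows "num_solutions {i} a t \<le> 1"
proof (induction t rule: less_induct)
  case (less t)
  show ?case
  proof (cases "t < a i")
    case True
    then show ?thesis
      using num_solutions_below[of "{i}" i t a] by (simp add: num_solutions_empty)
  next
    case False
    then obtain u where u: "t = u + a i" by (metis add.commute le_Suc_ex not_less)
    then show ?thesis
      using num_solutions_add[of "{i}" a i u] assms less[of u] by (simp add: num_solutions_empty)
  qed
qed

lemma num_solutions_le:
  assumes "finite I" "I \<noteq> {}" "\<And>i. i \<in> I \<Longrightarrow> 0 < a i"
  shows "num_solutions I a t \<le> (t + 1) ^ (card I - 1)"
  using assms
proof (induction I arbitrary: t rule: finite_ne_induct)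
  case (singleton i)
  then show ?case using num_solutions_singleton[of a i t] by simp
next
  case (insert i I)
  from insert.hyps obtain m where m: "card I = Suc m" by (cases "card I") auto
  have IH: "num_solutions I a t \<le> (t + 1) ^ m" for t
    using insert.IH[of t] insert.prems m by simp
  have rem: "insert i I - {i} = I" using insert.hyps by auto
  have "num_solutions (insert i I) a t \<le> (t + 1) ^ Suc m"
  proof (induction t rule: less_induct)
    case (less t)
    show ?case
    proof (cases "t < a i")
      case True
      then have "num_solutions (insert i I) a t = num_solutions I a t"
        using num_solutions_below[of "insert i I" i t a] insert.hyps by (simp add: rem)
      also have "\<dots> \<le> (t + 1) ^ m" by (rule IH)
      also have "\<dots> \<le> (t + 1) ^ Suc m" by (rule power_increasing) auto
      finally show ?thesis .
    next
      case False
      then obtain u where u: "t = u + a i" by (metis add.commute le_Suc_ex not_less)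
      have pos: "0 < a i" using insert.prems by simp
      have "num_solutions (insert i I) a t = num_solutions (insert i I) a u + num_solutions I a t"
        using num_solutions_add[of "insert i I" a i u] insert.hyps insert.prems
        by (simp add: u rem)
      also have "\<dots> \<le> (u + 1) ^ Suc m + (t + 1) ^ m"
        using less[of u] pos by (intro add_mono IH) (simp add: u)
      \<comment> \<open>Since \<open>u + 1 \<le> t\<close>, the two summands together stay below
        \<open>(t + 1) * (t + 1) ^ m\<close>.\<close>
      also have "(u + 1) ^ Suc m \<le> t * (t + 1) ^ m"
        unfolding power_Suc using pos by (intro mult_mono power_mono) (auto simp: u)
      finally show ?thesis by simp
    qed
  qed
  then show ?case using insert.hyps m by simp
qed

lemma num_solutions_add_multiple:
  assumes "finite I" "\<And>j. j \<in> I \<Longrightarrow> 0 < a j" "i \<in> I"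
  shows "num_solutions I a t \<le> num_solutions I a (t + k * a i)"
proof (induction k)
  case (Suc k)
  have "num_solutions I a (t + k * a i) \<le> num_solutions I a (t + k * a i + a i)"
    using num_solutions_add[of I a i "t + k * a i"] assms by simp
  with Suc show ?case by (simp add: algebra_simps)
qed simp

lemma num_solutions_zero_pos:
  assumes "finite I" "\<And>j. j \<in> I \<Longrightarrow> 0 < a j"
  shows "0 < num_solutions I a 0"
proof -
  have "(\<lambda>_. 0) \<in> solutions I a 0" by (simp add: solutions_def)
  then show ?thesis
    using finite_solutions[of I a 0] assms by (auto simp: num_solutions_def card_gt_0_iff)
qed

text \<open>The binomial is the exact count when every \<open>a i\<close> equals \<open>M\<close>.
  In general, going from \<open>M * q\<close> to \<open>M * Suc q\<close> takes
  \<open>M / a i\<close> steps of size \<open>a i\<close>: all but the last only need monotonicity,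
  and the last adds the count without \<open>i\<close>, which is Pascal's rule.\<close>

lemma num_solutions_common_multiple_ge:
  assumes "finite I" "I \<noteq> {}" "\<And>i. i \<in> I \<Longrightarrow> 0 < a i" "\<And>i. i \<in> I \<Longrightarrow> a i dvd M" "0 < M"
  shows "(q + (card I - 1)) choose (card I - 1) \<le> num_solutions I a (M * q)"
  using assms
proof (induction I arbitrary: q rule: finite_ne_induct)
  case (singleton i)
  obtain l where l: "M = a i * l" using singleton by auto
  have "0 < num_solutions {i} a 0"
    using singleton by (intro num_solutions_zero_pos) auto
  also have "\<dots> \<le> num_solutions {i} a (0 + (l * q) * a i)"
    using singleton by (intro num_solutions_add_multiple) auto
  finally show ?case by (simp add: l mult_ac)
next
  case (insert i I)
  from insert.hyps obtain m where m: "card I = Suc m" by (cases "card I") auto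
  have IH: "(q + m) choose m \<le> num_solutions I a (M * q)" for q
    using insert.IH[of q] insert.prems m by simp
  have rem: "insert i I - {i} = I" using insert.hyps by auto
  obtain l where l: "M = a i * l" using insert.prems(2)[of i] by auto
  with insert.prems obtain l' where l': "l = Suc l'" by (cases l) auto
  have "(q + Suc m) choose Suc m \<le> num_solutions (insert i I) a (M * q)"
  proof (induction q)
    case 0
    then show ?case
      using num_solutions_zero_pos[of "insert i I" a] insert by simp
  next
    case (Suc q)
    have eq: "M * q + l' * a i + a i = M * Suc q" by (simp add: l l' algebra_simps)
    have "(Suc q + Suc m) choose Suc m = ((q + Suc m) choose Suc m) + ((Suc q + m) choose m)"
      by simp
    also have "\<dots> \<le> num_solutions (insert i I) a (M * q) + num_solutions I a (M * Suc q)"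
      by (intro add_mono Suc IH)
    also have "num_solutions (insert i I) a (M * q)
        \<le> num_solutions (insert i I) a (M * q + l' * a i)"
      using insert by (intro num_solutions_add_multiple) auto
    also have "\<dots> + num_solutions I a (M * Suc q) = num_solutions (insert i I) a (M * Suc q)"
      using num_solutions_add[of "insert i I" a i "M * q + l' * a i"] insert
      by (simp add: rem eq del: mult_Suc_right)
    finally show ?case by simp
  qed
  then show ?case using insert.hyps m by simp
qed

section \<open>Drift estimates and their passage to the gcd of the step sizes\<close>

text \<open>Euclid's algorithm stays inside \<open>H\<close>. Closure under differences is phrased
  with \<open>x + y\<close> to avoid truncated subtraction.\<close>

lemma gcd_in_closed_set:
  fixes H :: "nat set"
  assumes add: "\<And>x y. x \<in> H \<Longrightarrow> y \<in> H \<Longrightarrow> x + y \<in> H"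
    and diff: "\<And>x y. x + y \<in> H \<Longrightarrow> y \<in> H \<Longrightarrow> x \<in> H"
    and zero: "0 \<in> H"
  shows "x \<in> H \<Longrightarrow> y \<in> H \<Longrightarrow> gcd x y \<in> H"
proof (induction x y rule: gcd_nat_induct)
  case (step m n)
  have mult: "k * n \<in> H" for k
    by (induction k) (auto intro: zero add step.prems)
  have "m mod n \<in> H"
    by (rule diff[where y = "m div n * n"]) (use step.prems mult in auto)
  with step show ?case by (simp add: gcd_red_nat[of m n])
qed simp

lemma Gcd_in_closed_set:
  fixes H :: "nat set"
  assumes "\<And>x y. x \<in> H \<Longrightarrow> y \<in> H \<Longrightarrow> x + y \<in> H"
    and "\<And>x y. x + y \<in> H \<Longrightarrow> y \<in> H \<Longrightarrow> x \<in> H"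
    and "0 \<in> H" "finite A" "A \<subseteq> H"
  shows "Gcd A \<in> H"
  using assms(4,5)
proof (induction A rule: finite_induct)
  case (insert x A)
  then have mem: "x \<in> H" "Gcd A \<in> H" by auto
  have "gcd x (Gcd A) \<in> H"
  proof (intro gcd_in_closed_set[where H = H], goal_cases)
    case (1 x y)
    then show ?case by (rule assms(1))
  next
    case (2 x y)
    then show ?case by (rule assms(2))
  qed (use assms(3) mem in auto)
  then show ?case by simp
qed (simp add: assms(3))

lemma bigo_powr_shift:
  fixes f :: "nat \<Rightarrow> real"
  assumes "f \<in> O(\<lambda>t. real t powr p)"
  shows "(\<lambda>t. f (t + h)) \<in> O(\<lambda>t. real t powr p)"
proof -
  have "filterlim (\<lambda>t :: nat. t + h) at_top at_top"
    by (rule filterlim_add_const_nat_at_top)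
  then have "(\<lambda>t. f (t + h)) \<in> O(\<lambda>t. real (t + h) powr p)"
    using landau_o.big.compose[OF assms] by blast
  also have "(\<lambda>t. real (t + h) powr p) \<in> O(\<lambda>t. real t powr p)"
    by real_asymp
  finally show ?thesis .
qed

text \<open>Substitute \<open>t - h\<close> for \<open>t\<close>; the truncation is invisible once
  \<open>t \<ge> h\<close>. This serves differences of step sizes, whose estimate first appears at a
  shifted argument.\<close>

lemma bigo_powr_unshift:
  fixes f :: "nat \<Rightarrow> real"
  assumes "(\<lambda>t. f (t + h)) \<in> O(\<lambda>t. real t powr p)"
  shows "f \<in> O(\<lambda>t. real t powr p)"
proof -
  have "filterlim (\<lambda>t :: nat. t - h) at_top at_top"
    by (rule filterlim_minus_const_nat_at_top)
  then have "(\<lambda>t. f (t - h + h)) \<in> O(\<lambda>t. real (t - h) powr p)"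
    using landau_o.big.compose[OF assms] by blast
  also have "(\<lambda>t. real (t - h) powr p) \<in> \<Theta>(\<lambda>t. (real t - real h) powr p)"
    by (intro bigthetaI_cong eventually_mono[OF eventually_ge_at_top[of h]]) (simp add: of_nat_diff)
  also have "(\<lambda>t. (real t - real h) powr p) \<in> O(\<lambda>t. real t powr p)"
    by real_asymp
  also have "(\<lambda>t. f (t - h + h)) \<in> O(\<lambda>t. real t powr p) \<longleftrightarrow> f \<in> O(\<lambda>t. real t powr p)"
    by (intro landau_o.big.in_cong eventually_mono[OF eventually_ge_at_top[of h]]) simp
  finally show ?thesis .
qed

lemma slowly_varying_shift:
  fixes w :: "nat \<Rightarrow> real"
  assumes "(\<lambda>t. w (t + 1) - w t) \<in> O(\<lambda>t. real t powr p)"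
  shows "(\<lambda>t. w (t + h) - w t) \<in> O(\<lambda>t. real t powr p)"
proof (induction h)
  case (Suc h)
  show ?case
    using sum_in_bigo(1)[OF Suc bigo_powr_shift[OF assms, of h]] by (simp add: algebra_simps)
qed simp

text \<open>Split the increment at \<open>t + y\<close>. The first part has rate
  \<open>w (t + y)\<close>, and replacing it by \<open>w t\<close> costs
  \<open>x * (w (t + y) - w t)\<close>, which slow variation absorbs.\<close>

lemma drift_add:
  fixes f w :: "nat \<Rightarrow> real"
  assumes w: "(\<lambda>t. w (t + 1) - w t) \<in> O(\<lambda>t. real t powr p)"
    and x: "(\<lambda>t. f (t + x) - f t - real x * w t) \<in> O(\<lambda>t. real t powr p)"
    and y: "(\<lambda>t. f (t + y) - f t - real y * w t) \<in> O(\<lambda>t. real t powr p)"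
  shows "(\<lambda>t. f (t + (x + y)) - f t - real (x + y) * w t) \<in> O(\<lambda>t. real t powr p)"
proof -
  have "(\<lambda>t. real x * (w (t + y) - w t)) \<in> O(\<lambda>t. real t powr p)"
    using slowly_varying_shift[OF w, of y] by simp
  from sum_in_bigo(1)[OF sum_in_bigo(1)[OF bigo_powr_shift[OF x, of y] y] this]
  show ?thesis by (simp add: algebra_simps)
qed

lemma drift_diff:
  fixes f w :: "nat \<Rightarrow> real"
  assumes w: "(\<lambda>t. w (t + 1) - w t) \<in> O(\<lambda>t. real t powr p)"
    and xy: "(\<lambda>t. f (t + (x + y)) - f t - real (x + y) * w t) \<in> O(\<lambda>t. real t powr p)"
    and y: "(\<lambda>t. f (t + y) - f t - real y * w t) \<in> O(\<lambda>t. real t powr p)"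
  shows "(\<lambda>t. f (t + x) - f t - real x * w t) \<in> O(\<lambda>t. real t powr p)"
proof (rule bigo_powr_unshift[where h = y])
  have "(\<lambda>t. real x * (w (t + y) - w t)) \<in> O(\<lambda>t. real t powr p)"
    using slowly_varying_shift[OF w, of y] by simp
  \<comment> \<open>Subtracting leaves the increment from \<open>t + y\<close> to
    \<open>t + y + x\<close>, with the rate corrected from \<open>w t\<close> to
    \<open>w (t + y)\<close>.\<close>
  from sum_in_bigo(2)[OF sum_in_bigo(2)[OF xy y] this]
  show "(\<lambda>t. f (t + y + x) - f (t + y) - real x * w (t + y)) \<in> O(\<lambda>t. real t powr p)"
    by (simp add: algebra_simps)
qed

lemma drift_multiple:
  fixes f w :: "nat \<Rightarrow> real"
  assumes "(\<lambda>t. w (t + 1) - w t) \<in> O(\<lambda>t. real t powr p)"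
    and "(\<lambda>t. f (t + x) - f t - real x * w t) \<in> O(\<lambda>t. real t powr p)"
  shows "(\<lambda>t. f (t + k * x) - f t - real (k * x) * w t) \<in> O(\<lambda>t. real t powr p)"
proof (induction k)
  case (Suc k)
  show ?case using drift_add[OF assms Suc] by simp
qed simp

text \<open>Used with \<open>w = 0\<close> to obtain slow variation of a count, and with
  \<open>w = W k / a k\<close> to obtain its actual rate of growth.\<close>

lemma drift_Gcd:
  fixes f w :: "nat \<Rightarrow> real"
  assumes "(\<lambda>t. w (t + 1) - w t) \<in> O(\<lambda>t. real t powr p)" "finite A"
    and "\<And>x. x \<in> A \<Longrightarrow> (\<lambda>t. f (t + x) - f t - real x * w t) \<in> O(\<lambda>t. real t powr p)"
  shows "(\<lambda>t. f (t + Gcd A) - f t - real (Gcd A) * w t) \<in> O(\<lambda>t. real t powr p)"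
proof -
  let ?H = "{x. (\<lambda>t. f (t + x) - f t - real x * w t) \<in> O(\<lambda>t. real t powr p)}"
  have "Gcd A \<in> ?H"
  proof (rule Gcd_in_closed_set, goal_cases)
    case (1 x y)
    then show ?case using drift_add[OF assms(1), of f x y] by blast
  next
    case (2 x y)
    then show ?case using drift_diff[OF assms(1), of f x y] by blast
  qed (use assms in auto)
  then show ?thesis by blast
qed

section \<open>Asymptotic growth of the number of solutions\<close>

text \<open>Real exponents keep the estimates uniform, since the orders here and below can be
  negative for few unknowns.\<close>

lemma num_solutions_bigo:
  assumes "finite I" "\<And>i. i \<in> I \<Longrightarrow> 0 < a i"
  shows "(\<lambda>t. real (num_solutions I a t)) \<in> O(\<lambda>t. real t powr (real (card I) - 1))"
proof (cases "I = {}")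
  case True
  \<comment> \<open>The exponent is -1, but the count vanishes for every positive
    \<open>t\<close>.\<close>
  have "eventually (\<lambda>t. real (num_solutions I a t) = 0) at_top"
    using eventually_gt_at_top[of 0] by eventually_elim (simp add: True num_solutions_empty)
  then show ?thesis by (intro bigoI[where c = 1]) (auto elim: eventually_mono)
next
  case False
  with assms(1) obtain m where m: "card I = Suc m" by (cases "card I") auto
  have "real (num_solutions I a t) \<le> (real t + 1) ^ m" for t
  proof -
    have "real (num_solutions I a t) \<le> real ((t + 1) ^ m)"
      using num_solutions_le[of I a t] assms False m by (subst of_nat_le_iff) simp
    then show ?thesis by (simp add: add_ac)
  qed
  then have "(\<lambda>t. real (num_solutions I a t)) \<in> O(\<lambda>t. (real t + 1) ^ m)"
    by (intro bigoI[where c = 1] always_eventually) simp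
  also have "(\<lambda>t. (real t + 1) ^ m) \<in> \<Theta>(\<lambda>t. (real t + 1) powr real m)"
    by (simp add: powr_realpow add_pos_pos)
  also have "(\<lambda>t. (real t + 1) powr real m) \<in> O(\<lambda>t. real t powr real m)"
    by real_asymp
  finally show ?thesis by (simp add: m)
qed

text \<open>A step of size \<open>a i\<close> changes the count by a count in one unknown fewer,
  hence of order one less than the count itself; with drift 0 this passes to the step 1, the
  gcd.\<close>

lemma num_solutions_slowly_varying:
  assumes "finite I" "\<And>i. i \<in> I \<Longrightarrow> 0 < a i" "Gcd (a ` I) = 1"
  shows "(\<lambda>t. real (num_solutions I a (t + 1)) - real (num_solutions I a t))
           \<in> O(\<lambda>t. real t powr (real (card I) - 2))"
proof -
  have "(\<lambda>t. real (num_solutions I a (t + a i)) - real (num_solutions I a t) - real (a i) * 0)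
           \<in> O(\<lambda>t. real t powr (real (card I) - 2))" if i: "i \<in> I" for i
  proof -
    have "card I = Suc (card (I - {i}))" using i assms(1) by (metis card_Suc_Diff1)
    then have "real (card I) - 2 = real (card (I - {i})) - 1" by simp
    moreover have "(\<lambda>t. real (num_solutions (I - {i}) a (t + a i)))
        \<in> O(\<lambda>t. real t powr (real (card (I - {i})) - 1))"
      by (rule bigo_powr_shift, rule num_solutions_bigo) (use assms in auto)
    moreover have "real (num_solutions I a (t + a i)) - real (num_solutions I a t) - real (a i) * 0
        = real (num_solutions (I - {i}) a (t + a i))" for t
      using num_solutions_add[of I a i t] assms i by simp
    ultimately show ?thesis by (simp only:)
  qed
  then have "(\<lambda>t. real (num_solutions I a (t + Gcd (a ` I))) - real (num_solutions I a t)
      - real (Gcd (a ` I)) * 0) \<in> O(\<lambda>t. real t powr (real (card I) - 2))"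
    using assms(1) by (intro drift_Gcd[where w = "\<lambda>_. 0"]) auto
  then show ?thesis using assms(3) by simp
qed

text \<open>The binomial bound holds only at multiples of \<open>M\<close>. Summing over a window of
  length \<open>M\<close> gives a bound at every \<open>t\<close>, and slow variation lets
  \<open>M * N t\<close> replace that sum up to lower order.\<close>

lemma num_solutions_lower_bound:
  assumes "finite I" "I \<noteq> {}" "\<And>i. i \<in> I \<Longrightarrow> 0 < a i" "Gcd (a ` I) = 1"
  shows "\<exists>c>0. eventually (\<lambda>t. c * real t powr (real (card I) - 1) \<le> real (num_solutions I a t)) at_top"
proof -
  define N where "N = (\<lambda>t. real (num_solutions I a t))"
  define M where "M = (\<Prod>i\<in>I. a i)"
  define m where "m = card I - 1"
  have m: "real (card I) - 1 = real m" "real (card I) - 2 = real m - 1"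
    using assms(1,2) by (auto simp: m_def of_nat_diff Suc_leI card_gt_0_iff)
  have M: "0 < M" using assms(3) by (simp add: M_def prod_pos)
  \<comment> \<open>Comes from \<open>t \<le> M * q\<close> and
    \<open>((q + m) / m) ^ m \<le> (q + m) choose m\<close>; using \<open>m + 1\<close> keeps the
    base positive also for \<open>m = 0\<close>.\<close>
  define c where "c = 1 / (real M * (real m + 1)) ^ m"
  have c: "0 < c" using M by (simp add: c_def)
  \<comment> \<open>Every window of length \<open>M\<close> contains a multiple of \<open>M\<close>, where the binomial bound applies.\<close>
  have window: "c * real t ^ m \<le> (\<Sum>h<M. N (t + h))" for t
  proof -
    \<comment> \<open>This is \<open>t / M\<close> rounded up, so \<open>M * q\<close> is the
      multiple of \<open>M\<close> in the window starting at \<open>t\<close>.\<close>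
    define q where "q = (t + M - 1) div M"
    have q: "t \<le> M * q" "M * q < t + M"
    proof -
      have eq: "M * q + (t + M - 1) mod M = t + M - 1" by (simp add: q_def)
      moreover have "(t + M - 1) mod M < M" using M by simp
      ultimately show "t \<le> M * q" "M * q < t + M" using M by linarith+
    qed
    have "c * real t ^ m = (real t / (real M * (real m + 1))) ^ m"
      by (simp add: c_def power_divide)
    also have "\<dots> \<le> (real (q + m) / real m) ^ m"
    \<comment> \<open>For \<open>m = 0\<close> the quotient on the right is a division by zero, but
      both powers are 1.\<close>
    proof (cases "m = 0")
      case False
      have "real t \<le> real M * real q" using q(1) by (metis of_nat_le_iff of_nat_mult)
      then have "real t / (real M * (real m + 1)) \<le> (real M * real q) / (real M * (real m + 1))"
        by (intro divide_right_mono) auto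
      also have "\<dots> = real q / (real m + 1)" using M by simp
      also have "\<dots> \<le> real (q + m) / real m"
        using False by (intro frac_le) auto
      finally show ?thesis by (intro power_mono) auto
    qed simp
    also have "\<dots> \<le> real ((q + m) choose m)"
      using binomial_ge_n_over_k_pow_k[of m "q + m", where 'a = real] by simp
    also have "\<dots> \<le> N (M * q)"
      using num_solutions_common_multiple_ge[of I a M q] assms M
      by (auto simp: N_def m_def M_def)
    also have "\<dots> = N (t + (M * q - t))" using q by simp
    also have "\<dots> \<le> (\<Sum>h<M. N (t + h))"
      using q by (intro member_le_sum[of _ _ "\<lambda>h. N (t + h)"]) (auto simp: N_def)
    finally show ?thesis .
  qed
  have "(\<lambda>t. N (t + 1) - N t) \<in> O(\<lambda>t. real t powr (real m - 1))"
    using num_solutions_slowly_varying[OF assms(1,3,4)] m by (simp add: N_def)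
  then have "(\<lambda>t. \<Sum>h<M. N (t + h) - N t) \<in> O(\<lambda>t. real t powr (real m - 1))"
    by (rule big_sum_in_bigo[OF slowly_varying_shift])
  also have "(\<lambda>t. real t powr (real m - 1)) \<in> o(\<lambda>t. real t powr real m)"
    by real_asymp
  \<comment> \<open>The deviation of the window sum from \<open>M * N t\<close> may consume half of
    the window bound; the other half survives.\<close>
  finally have "eventually (\<lambda>t. norm (\<Sum>h<M. N (t + h) - N t) \<le> c / 2 * norm (real t powr real m)) at_top"
    using c by (intro landau_o.smallD) auto
  then have "eventually (\<lambda>t. c / (2 * real M) * real t powr real m \<le> N t) at_top"
    using eventually_gt_at_top[of 0]
  proof eventually_elim
    case (elim t)
    have "(\<Sum>h<M. N (t + h)) = (\<Sum>h<M. N (t + h) - N t) + real M * N t"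
      by (simp add: sum_subtractf)
    moreover have "c * real t powr real m \<le> (\<Sum>h<M. N (t + h))"
      using window[of t] elim by (simp add: powr_realpow)
    ultimately have "c / 2 * real t powr real m \<le> real M * N t"
      using elim by (simp add: abs_le_iff)
    then show ?case using M by (simp add: field_simps)
  qed
  moreover have "0 < c / (2 * real M)" using c M by simp
  ultimately show ?thesis unfolding m N_def by blast
qed

text \<open>The gcd condition on every omitted family makes every \<open>W i\<close> slowly varying;
  it also forces the full gcd to be 1, so the common rate applies to the step 1.\<close>

lemma num_solutions_strict_increasing:
  assumes "finite I" "2 \<le> card I" "\<And>i. i \<in> I \<Longrightarrow> 0 < a i"
    and gcd1: "\<And>i. i \<in> I \<Longrightarrow> Gcd (a ` (I - {i})) = 1"
  shows "eventually (\<lambda>t. num_solutions I a t < num_solutions I a (t + 1)) at_top"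
proof -
  \<comment> \<open>Errors will have order \<open>p\<close> and the main term order
    \<open>p + 1\<close>; with two unknowns these are -1 and 0.\<close>
  define p where "p = real (card I) - 3"
  define f where "f = (\<lambda>t. real (num_solutions I a t))"
  define W where "W = (\<lambda>i t. real (num_solutions (I - {i}) a t))"
  have card_I: "real (card (I - {i})) = real (card I) - 1" if "i \<in> I" for i
    using that assms(1,2) by (simp add: of_nat_diff)
  have slow: "(\<lambda>t. W i (t + 1) - W i t) \<in> O(\<lambda>t. real t powr p)" if i: "i \<in> I" for i
    using num_solutions_slowly_varying[of "I - {i}" a] assms i card_I[OF i]
    by (simp add: W_def p_def)
  have slow': "(\<lambda>t. W i (t + 1) / real (a i) - W i t / real (a i)) \<in> O(\<lambda>t. real t powr p)"
    if i: "i \<in> I" for i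
    using slow[OF i] assms(3)[OF i] by (simp flip: diff_divide_distrib)
  have step: "f (t + a i) - f t = W i (t + a i)" if "i \<in> I" for i t
    using num_solutions_add[of I a i t] assms that by (simp add: f_def W_def)
  \<comment> \<open>The exact increment is \<open>W i (t + a i)\<close>, and slow variation moves
    its argument back to \<open>t\<close>.\<close>
  have drift: "(\<lambda>t. f (t + a i) - f t - real (a i) * (W i t / real (a i))) \<in> O(\<lambda>t. real t powr p)"
    if i: "i \<in> I" for i
    using slowly_varying_shift[OF slow[OF i], of "a i"] assms(3)[OF i] by (simp add: step[OF i])
  from assms(2) obtain k where k: "k \<in> I" by fastforce
  have same_drift: "(\<lambda>t. W i t / real (a i) - W k t / real (a k)) \<in> O(\<lambda>t. real t powr p)"
    if i: "i \<in> I" for i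
  proof -
    have "(\<lambda>t. f (t + a k * a i) - f t - real (a k * a i) * (W i t / real (a i)))
        \<in> O(\<lambda>t. real t powr p)"
      by (rule drift_multiple[OF slow'[OF i] drift[OF i]])
    moreover have "(\<lambda>t. f (t + a i * a k) - f t - real (a i * a k) * (W k t / real (a k)))
        \<in> O(\<lambda>t. real t powr p)"
      by (rule drift_multiple[OF slow'[OF k] drift[OF k]])
    \<comment> \<open>Both estimates concern the same displacement \<open>a i * a k\<close>, so
      \<open>f\<close> cancels and only the two rates are compared.\<close>
    ultimately have "(\<lambda>t. (f (t + a i * a k) - f t - real (a i * a k) * (W k t / real (a k)))
        - (f (t + a k * a i) - f t - real (a k * a i) * (W i t / real (a i))))
        \<in> O(\<lambda>t. real t powr p)"
      by (rule sum_in_bigo(2)[rotated])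
    also have "(\<lambda>t. (f (t + a i * a k) - f t - real (a i * a k) * (W k t / real (a k)))
        - (f (t + a k * a i) - f t - real (a k * a i) * (W i t / real (a i))))
        = (\<lambda>t. real (a i * a k) * (W i t / real (a i) - W k t / real (a k)))"
      by (simp add: algebra_simps)
    finally show ?thesis using assms(3)[OF i] assms(3)[OF k] by simp
  qed
  \<comment> \<open>Every step size now gets the same rate \<open>W k / a k\<close>, as
    \<open>drift_Gcd\<close> requires.\<close>
  have "(\<lambda>t. f (t + x) - f t - real x * (W k t / real (a k))) \<in> O(\<lambda>t. real t powr p)"
    if "x \<in> a ` I" for x
  proof -
    from that obtain i where i: "i \<in> I" "x = a i" by auto
    have "(\<lambda>t. real (a i) * (W i t / real (a i) - W k t / real (a k))) \<in> O(\<lambda>t. real t powr p)"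
      using same_drift[OF i(1)] by simp
    from sum_in_bigo(1)[OF drift[OF i(1)] this] show ?thesis
      by (simp add: i(2) algebra_simps)
  qed
  then have "(\<lambda>t. f (t + Gcd (a ` I)) - f t - real (Gcd (a ` I)) * (W k t / real (a k)))
      \<in> O(\<lambda>t. real t powr p)"
    using assms(1) by (intro drift_Gcd slow'[OF k]) auto
  moreover have "Gcd (a ` I) = 1"
  proof -
    have "Gcd (a ` I) dvd Gcd (a ` (I - {k}))" by (intro Gcd_greatest Gcd_dvd) auto
    then show ?thesis using gcd1[OF k] by simp
  qed
  ultimately have "(\<lambda>t. f (t + 1) - f t - W k t / real (a k)) \<in> O(\<lambda>t. real t powr p)"
    by simp
  also have "(\<lambda>t. real t powr p) \<in> o(\<lambda>t. real t powr (p + 1))"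
    by real_asymp
  finally have main: "(\<lambda>t. f (t + 1) - f t - W k t / real (a k)) \<in> o(\<lambda>t. real t powr (p + 1))" .
  have "card (I - {k}) \<noteq> 0" using k assms(1,2) by simp
  then have "I - {k} \<noteq> {}" by (metis card.empty)
  then obtain c where c: "0 < c"
      "eventually (\<lambda>t. c * real t powr (p + 1) \<le> W k t) at_top"
    using num_solutions_lower_bound[of "I - {k}" a] assms k card_I[OF k]
    by (auto simp: W_def p_def)
  \<comment> \<open>The error is held to half of the lower bound \<open>c / a k\<close> for the
    rate, so the increment stays positive.\<close>
  have "eventually (\<lambda>t. norm (f (t + 1) - f t - W k t / real (a k))
      \<le> c / (2 * real (a k)) * norm (real t powr (p + 1))) at_top"
    using c assms(3)[OF k] by (intro landau_o.smallD[OF main]) auto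
  with c(2) eventually_gt_at_top[of 0] show ?thesis
  proof eventually_elim
    case (elim t)
    have "c / real (a k) * real t powr (p + 1) \<le> W k t / real (a k)"
      using elim assms(3)[OF k] by (simp add: field_simps)
    moreover have "0 < c / (2 * real (a k)) * real t powr (p + 1)"
      using elim c assms(3)[OF k] by simp
    moreover have "c / real (a k) * real t powr (p + 1)
        = 2 * (c / (2 * real (a k)) * real t powr (p + 1))" by simp
    moreover have "\<bar>f (t + 1) - f t - W k t / real (a k)\<bar>
        \<le> c / (2 * real (a k)) * real t powr (p + 1)" using elim by simp
    ultimately have "f t < f (t + 1)" by linarith
    then show ?case by (simp add: f_def)
  qed
qed

section \<open>Arithmetic of the omitted gcds and the reduced vector\<close>

lemma set_omit:
  assumes "i < length a"
  shows "set (omit i a) = (!) a ` ({..<length a} - {i})"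
proof
  show "set (omit i a) \<subseteq> (!) a ` ({..<length a} - {i})"
    using assms by (force simp: omit_def in_set_conv_nth)
  have "a ! j \<in> set (omit i a)" if j: "j < length a" "j \<noteq> i" for j
  proof (cases "j < i")
    case True
    then have "take i a ! j = a ! j" "j < length (take i a)" using j by auto
    then show ?thesis unfolding omit_def by (metis UnI1 nth_mem set_append)
  next
    case False
    then have "drop (Suc i) a ! (j - Suc i) = a ! j" "j - Suc i < length (drop (Suc i) a)"
      using j by auto
    then show ?thesis unfolding omit_def by (metis UnI2 nth_mem set_append)
  qed
  then show "(!) a ` ({..<length a} - {i}) \<subseteq> set (omit i a)" by auto
qed

text \<open>With at least two entries a positive entry survives the omission; for a single entry the
  value would be \<open>Gcd {} = 0\<close>.\<close>

lemma omit_gcd_pos: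
  assumes "2 \<le> length a" "\<forall>k\<in>set a. 0 < k"
  shows "0 < omit_gcd a i"
proof -
  obtain j where j: "j < length a" "i \<noteq> j"
    using assms(1) by (intro that[of "if i = 0 then 1 else 0"]) auto
  then have "omit_gcd a i dvd a ! j" by (intro omit_gcd_dvd)
  then show ?thesis using assms(2) j by (metis dvd_0_left_iff gr0I nth_mem)
qed

text \<open>A common divisor would divide every entry. This makes \<open>a ! i\<close> invertible
  modulo \<open>omit_gcd a i\<close>.\<close>

lemma coprime_omit_gcd_nth:
  assumes "Gcd (set a) = 1" "i < length a"
  shows "coprime (a ! i) (omit_gcd a i)"
proof (rule coprimeI)
  fix c assume c: "c dvd a ! i" "c dvd omit_gcd a i"
  have "c dvd k" if "k \<in> set a" for k
  proof -
    obtain l where l: "l < length a" "k = a ! l" using \<open>k \<in> set a\<close> by (metis in_set_conv_nth)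
    show ?thesis
      using c l omit_gcd_dvd[of l a i] by (cases "l = i") (auto intro: dvd_trans)
  qed
  then have "c dvd Gcd (set a)" by (rule Gcd_greatest)
  then show "is_unit c" using assms(1) by simp
qed

lemma length_reduced_vector [simp]: "length (reduced_vector a) = length a"
  by (simp add: reduced_vector_def)

lemma nth_reduced_vector:
  assumes "Gcd (set a) = 1" "i < length a"
  shows "a ! i = reduced_vector a ! i * (\<Prod>j\<in>{..<length a} - {i}. omit_gcd a j)"
proof -
  let ?P = "\<Prod>j\<in>{..<length a} - {i}. omit_gcd a j"
  have "reduced_vector a ! i = a ! i div ?P" using assms(2) by (simp add: reduced_vector_def)
  then show ?thesis using dvd_div_mult_self[OF prod_omit_gcd_dvd[OF assms]] by simp
qed

text \<open>This identity lets the substitution \<open>x i = b i + d i * y i\<close> extract the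
  factor \<open>omit_gcd_prod a\<close> from the sum.\<close>

lemma nth_mult_omit_gcd:
  assumes "Gcd (set a) = 1" "i < length a"
  shows "a ! i * omit_gcd a i = reduced_vector a ! i * omit_gcd_prod a"
proof -
  have "omit_gcd_prod a = omit_gcd a i * (\<Prod>j\<in>{..<length a} - {i}. omit_gcd a j)"
    unfolding omit_gcd_prod_def using assms(2) by (intro prod.remove) auto
  then show ?thesis using nth_reduced_vector[OF assms] by (simp add: mult_ac)
qed

lemma reduced_vector_pos:
  assumes "\<forall>k\<in>set a. 0 < k" "Gcd (set a) = 1" "i < length a"
  shows "0 < reduced_vector a ! i"
proof (rule gr0I)
  assume "reduced_vector a ! i = 0"
  then have "a ! i = 0" using nth_reduced_vector[OF assms(2,3)] by simp
  then show False using assms(1,3) nth_mem by fastforce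
qed

text \<open>For \<open>j \<noteq> i\<close> the factor divided out of \<open>a ! j\<close> contains
  \<open>omit_gcd a i\<close>. So a common divisor \<open>c\<close> of the remaining reduced entries
  makes \<open>c * omit_gcd a i\<close> divide all \<open>a ! j\<close> with
  \<open>j \<noteq> i\<close>, hence divide \<open>omit_gcd a i\<close>.\<close>

lemma Gcd_omit_reduced_vector:
  assumes "2 \<le> length a" "\<forall>k\<in>set a. 0 < k" "Gcd (set a) = 1" "i < length a"
  shows "Gcd ((!) (reduced_vector a) ` ({..<length a} - {i})) = 1"
proof -
  let ?c = "Gcd ((!) (reduced_vector a) ` ({..<length a} - {i}))"
  have "?c * omit_gcd a i dvd Gcd (set (omit i a))"
  proof (rule Gcd_greatest)
    fix k assume "k \<in> set (omit i a)"
    then obtain j where j: "k = a ! j" "j < length a" "j \<noteq> i"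
      using set_omit[OF assms(4)] by auto
    have "?c dvd reduced_vector a ! j" using j by (intro Gcd_dvd) auto
    moreover have "omit_gcd a i dvd (\<Prod>l\<in>{..<length a} - {j}. omit_gcd a l)"
      using j assms(4) by (intro dvd_prodI) auto
    ultimately show "?c * omit_gcd a i dvd k"
      unfolding j(1) by (subst nth_reduced_vector[OF assms(3) j(2)]) (rule mult_dvd_mono)
  qed
  then have "?c * omit_gcd a i dvd 1 * omit_gcd a i" by (simp add: omit_gcd_def)
  then have "?c dvd 1"
    using omit_gcd_pos[OF assms(1,2), of i] dvd_times_right_cancel_iff[of "omit_gcd a i" ?c 1] by simp
  then show ?thesis by simp
qed

lemma sum_cong_omit_gcd:
  assumes "i < length a"
  shows "[(\<Sum>j<length a. a ! j * x j) = a ! i * x i] (mod omit_gcd a i)"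
proof -
  have "(\<Sum>j<length a. a ! j * x j) = a ! i * x i + (\<Sum>j\<in>{..<length a} - {i}. a ! j * x j)"
    using assms by (intro sum.remove) auto
  moreover have "omit_gcd a i dvd (\<Sum>j\<in>{..<length a} - {i}. a ! j * x j)"
    by (intro dvd_sum dvd_mult2 omit_gcd_dvd) auto
  ultimately show ?thesis
    using cong_add[OF cong_refl[of "a ! i * x i"], of _ 0] by (simp add: cong_0_iff)
qed

lemma omit_gcd_dvd_prod: "i < length a \<Longrightarrow> omit_gcd a i dvd omit_gcd_prod a"
  unfolding omit_gcd_prod_def by (intro dvd_prodI) auto

section \<open>Reduction to the reduced vector and representation of large numbers\<close>

text \<open>The right side is free of \<open>b\<close>, so this yields both (1) and, with
  \<open>b = 0\<close>, (3).\<close>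

lemma restricted_partition_reduced_vector:
  assumes "2 \<le> length a" "\<forall>k\<in>set a. 0 < k" "Gcd (set a) = 1"
    and b: "\<And>i. i < length a \<Longrightarrow> b i < omit_gcd a i"
  shows "restricted_partition a (s * omit_gcd_prod a + (\<Sum>i<length a. a ! i * b i))
           = restricted_partition (reduced_vector a) s"
proof -
  let ?n = "length a" and ?d = "omit_gcd a" and ?p = "omit_gcd_prod a" and ?r = "reduced_vector a"
  let ?t = "s * ?p + (\<Sum>i<?n. a ! i * b i)"
  have d_pos: "0 < ?d i" for i using omit_gcd_pos[OF assms(1,2)] .
  have p_pos: "0 < ?p" unfolding omit_gcd_prod_def using d_pos by (intro prod_pos) auto
  have sum_eq: "(\<Sum>j<?n. a ! j * (b j + ?d j * y j))
      = (\<Sum>j<?n. ?r ! j * y j) * ?p + (\<Sum>j<?n. a ! j * b j)" for y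
  proof -
    have "a ! j * (b j + ?d j * y j) = ?r ! j * y j * ?p + a ! j * b j" if "j < ?n" for j
      using nth_mult_omit_gcd[OF assms(3) that] by (metis distrib_left add.commute mult.assoc mult.commute)
    then show ?thesis by (simp add: sum.distrib sum_distrib_right)
  qed
  \<comment> \<open>Modulo \<open>?d i\<close> the equation reduces to
    \<open>a ! i * x i = a ! i * b i\<close>, where \<open>a ! i\<close> cancels;
    \<open>b i < ?d i\<close> makes \<open>b i\<close> the remainder itself.\<close>
  have residue: "x i mod ?d i = b i" if x: "x \<in> solutions {..<?n} ((!) a) ?t" and i: "i < ?n" for x i
  proof -
    have "[a ! i * x i = ?t] (mod ?d i)"
      using sum_cong_omit_gcd[OF i, of x] x by (simp add: solutions_def cong_sym)
    also have "[?t = 0 + a ! i * b i] (mod ?d i)"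
      using omit_gcd_dvd_prod[OF i] by (intro cong_add sum_cong_omit_gcd i) (simp add: cong_0_iff)
    finally have "[x i = b i] (mod ?d i)"
      using coprime_omit_gcd_nth[OF assms(3) i] by (simp only: cong_mult_lcancel_nat add_0)
    then show ?thesis using b[OF i] by (simp add: unique_euclidean_semiring_class.cong_def)
  qed
  have decomp: "x i = b i + ?d i * (x i div ?d i)"
    if "x \<in> solutions {..<?n} ((!) a) ?t" "i < ?n" for x i
    using residue[OF that] by (metis mod_mult_div_eq)
  let ?f = "\<lambda>y j. if j < ?n then b j + ?d j * y j else 0"
  let ?g = "\<lambda>x j. if j < ?n then x j div ?d j else 0"
  have "bij_betw ?f (solutions {..<?n} ((!) ?r) s) (solutions {..<?n} ((!) a) ?t)"
  proof (rule bij_betw_byWitness[where f' = ?g], goal_cases)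
    case 1
    show ?case using b d_pos by (auto simp: solutions_def fun_eq_iff)
  next
    case 2
    show ?case using decomp by (auto simp: fun_eq_iff solutions_def)
  next
    case 3
    show ?case by (auto simp: solutions_def sum_eq)
  next
    case 4
    show ?case
    proof (rule image_subsetI)
      fix x assume x: "x \<in> solutions {..<?n} ((!) a) ?t"
      have "(\<Sum>j<?n. ?r ! j * (x j div ?d j)) * ?p + (\<Sum>j<?n. a ! j * b j)
          = (\<Sum>j<?n. a ! j * x j)"
        unfolding sum_eq[symmetric] using decomp[OF x] by (intro sum.cong) auto
      also have "\<dots> = ?t" using x by (simp add: solutions_def)
      finally have "(\<Sum>j<?n. ?r ! j * (x j div ?d j)) = s" using p_pos by simp
      then show "?g x \<in> solutions {..<?n} ((!) ?r) s" by (simp add: solutions_def)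
    qed
  qed
  then show ?thesis
    by (simp add: restricted_partition_eq_num_solutions num_solutions_def bij_betw_same_card)
qed

text \<open>Solve \<open>a ! i * b i = t\<close> modulo each \<open>omit_gcd a i\<close>. The moduli
  are pairwise coprime, so the sum agrees with \<open>t\<close> modulo their product; the threshold
  on \<open>t\<close> keeps the quotient \<open>s\<close> nonnegative.\<close>

lemma omit_gcd_decomposition_of_large:
  assumes "2 \<le> length a" "\<forall>k\<in>set a. 0 < k" "Gcd (set a) = 1"
    and t: "(\<Sum>i<length a. a ! i * omit_gcd a i) \<le> t"
  shows "\<exists>s b. (\<forall>i<length a. b i < omit_gcd a i) \<and>
           t = s * omit_gcd_prod a + (\<Sum>i<length a. a ! i * b i)"
proof -
  let ?n = "length a" and ?d = "omit_gcd a"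
  have "\<exists>c<?d i. [a ! i * c = t] (mod ?d i)" if i: "i < ?n" for i
  proof -
    obtain c where c: "[a ! i * c = 1] (mod ?d i)"
      using cong_solve_coprime_nat[OF coprime_omit_gcd_nth[OF assms(3) i]] by auto
    have "[a ! i * (c * t mod ?d i) = a ! i * (c * t)] (mod ?d i)"
      by (intro cong_mult) auto
    also have "[a ! i * (c * t) = 1 * t] (mod ?d i)"
      using cong_mult[OF c cong_refl[of t]] by (simp add: mult.assoc)
    finally show ?thesis using omit_gcd_pos[OF assms(1,2), of i]
      by (intro exI[of _ "c * t mod ?d i"]) auto
  qed
  then obtain b where b: "\<And>i. i < ?n \<Longrightarrow> b i < ?d i"
      "\<And>i. i < ?n \<Longrightarrow> [a ! i * b i = t] (mod ?d i)"
    by metis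
  let ?S = "\<Sum>i<?n. a ! i * b i"
  have "?S \<le> (\<Sum>i<?n. a ! i * ?d i)"
    using b(1) by (intro sum_mono mult_le_mono2) (simp add: less_imp_le)
  with t have le: "?S \<le> t" by linarith
  have "[?S = t] (mod ?d i)" if "i < ?n" for i
    using cong_trans[OF sum_cong_omit_gcd[OF that, of b] b(2)[OF that]] .
  then have "[?S = t] (mod omit_gcd_prod a)"
    unfolding omit_gcd_prod_def
    by (intro coprime_cong_prod_nat) (auto intro: coprime_omit_gcd[OF assms(3)])
  then have "omit_gcd_prod a dvd t - ?S"
    using le by (simp add: cong_altdef_nat cong_sym_eq)
  then obtain s where "t - ?S = omit_gcd_prod a * s" by (rule dvdE)
  then have "t = s * omit_gcd_prod a + ?S" using le by (simp add: mult.commute)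
  with b(1) show ?thesis by blast
qed

theorem theorem1p8:
  fixes a :: "nat list"
  assumes "2 \<le> length a"
    and "\<forall>k\<in>set a. 0 < k"
    and "Gcd (set a) = 1"
  shows
    "(\<forall>s b. (\<forall>i<length a. b i < omit_gcd a i) \<longrightarrow>
        restricted_partition a (s * omit_gcd_prod a + (\<Sum>i<length a. a ! i * b i))
          = restricted_partition a (s * omit_gcd_prod a)) \<and>
     (\<exists>T. \<forall>t\<ge>T. \<exists>s b. (\<forall>i<length a. b i < omit_gcd a i) \<and>
        t = s * omit_gcd_prod a + (\<Sum>i<length a. a ! i * b i)) \<and>
     (\<forall>s. restricted_partition a (s * omit_gcd_prod a)
          = restricted_partition (reduced_vector a) s) \<and>
     (\<exists>S. \<forall>s\<ge>S. restricted_partition a ((s + 1) * omit_gcd_prod a)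
          > restricted_partition a (s * omit_gcd_prod a))"
proof (intro conjI)
  let ?n = "length a" and ?r = "reduced_vector a"
  have eq: "restricted_partition a (s * omit_gcd_prod a + (\<Sum>i<?n. a ! i * b i))
      = restricted_partition ?r s" if "\<forall>i<?n. b i < omit_gcd a i" for s b
    using restricted_partition_reduced_vector[OF assms] that by blast
  have eq0: "restricted_partition a (s * omit_gcd_prod a) = restricted_partition ?r s" for s
    using eq[of "\<lambda>_. 0" s] omit_gcd_pos[OF assms(1,2)] by simp
  show "\<forall>s b. (\<forall>i<?n. b i < omit_gcd a i) \<longrightarrow>
      restricted_partition a (s * omit_gcd_prod a + (\<Sum>i<?n. a ! i * b i))
        = restricted_partition a (s * omit_gcd_prod a)"
    using eq eq0 by simp
  show "\<exists>T. \<forall>t\<ge>T. \<exists>s b. (\<forall>i<?n. b i < omit_gcd a i) \<and>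
      t = s * omit_gcd_prod a + (\<Sum>i<?n. a ! i * b i)"
    using omit_gcd_decomposition_of_large[OF assms] by blast
  show "\<forall>s. restricted_partition a (s * omit_gcd_prod a) = restricted_partition ?r s"
    using eq0 by blast
  \<comment> \<open>By \<open>eq0\<close> a step of \<open>omit_gcd_prod a\<close> in the argument
    for \<open>a\<close> is a step of 1 for the reduced vector.\<close>
  have "eventually (\<lambda>s. num_solutions {..<?n} ((!) ?r) s < num_solutions {..<?n} ((!) ?r) (s + 1)) at_top"
    using assms by (intro num_solutions_strict_increasing)
      (auto intro!: reduced_vector_pos Gcd_omit_reduced_vector[unfolded One_nat_def])
  then show "\<exists>S. \<forall>s\<ge>S. restricted_partition a ((s + 1) * omit_gcd_prod a)
      > restricted_partition a (s * omit_gcd_prod a)"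
    unfolding eq0 by (simp add: restricted_partition_eq_num_solutions eventually_sequentially)
qed

end
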